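(* Let $\mathbf{w}_t=(\mathbf{x}_t,\mathbf{z}_t,\mathbf{y}_t)$, $t\ge 1$, be generated by the batch ADM iteration (described in the context) with penalty parameter $\rho>0$, started from $\mathbf{z}_0=\mathbf{0}$, $\mathbf{y}_0=\mathbf{0}$, and let $\bar{\mathbf{w}}_T=\frac1T\sum_{t=1}^T\mathbf{w}_t$. Then for all $\mathbf{w}\in\Omega=\mathcal{X}\times\mathcal{Z}\times\mathbb{R}^m$, $$h(\bar{\mathbf{w}}_T)-h(\mathbf{w})+(\bar{\mathbf{w}}_T-\mathbf{w})^TF(\bar{\mathbf{w}}_T)\le O\left(\frac1T\right),$$ that is, for every $\mathbf{w}\in\Omega$ there is a constant $C$ (depending on $\mathbf{w}$ and on the problem data and $\rho$, but not on $T$) such that the left-hand side is at most $C/T$ for every integer $T\ge1$.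
   Context: Setting: $\mathcal{X}\subseteq\mathbb{R}^{n_1}$ and $\mathcal{Z}\subseteq\mathbb{R}^{n_2}$ are nonempty convex sets, $f:\mathcal{X}\to\mathbb{R}$ and $g:\mathcal{Z}\to\mathbb{R}$ are convex (possibly non-smooth), $\mathbf{A}\in\mathbb{R}^{m\times n_1}$, $\mathbf{B}\in\mathbb{R}^{m\times n_2}$, $\mathbf{c}\in\mathbb{R}^m$. The problem is to minimize $f(\mathbf{x})+g(\mathbf{z})$ over $\mathbf{x}\in\mathcal{X},\mathbf{z}\in\mathcal{Z}$ subject to $\mathbf{A}\mathbf{x}+\mathbf{B}\mathbf{z}=\mathbf{c}$. Batch ADM: for $t=0,1,2,\dots$ $$\mathbf{x}_{t+1}\in\operatorname*{argmin}_{\mathbf{x}\in\mathcal{X}} f(\mathbf{x})+\langle\mathbf{y}_t,\mathbf{A}\mathbf{x}+\mathbf{B}\mathbf{z}_t-\mathbf{c}\rangle+\tfrac{\rho}{2}\|\mathbf{A}\mathbf{x}+\mathbf{B}\mathbf{z}_t-\mathbf{c}\|_2^2,$$ $$\mathbf{z}_{t+1}\in\operatorname*{argmin}_{\mathbf{z}\in\mathcal{Z}} g(\mathbf{z})+\langle\mathbf{y}_t,\mathbf{A}\mathbf{x}_{t+1}+\mathbf{B}\mathbf{z}-\mathbf{c}\rangle+\tfrac{\rho}{2}\|\mathbf{A}\mathbf{x}_{t+1}+\mathbf{B}\mathbf{z}-\mathbf{c}\|_2^2,$$ $$\mathbf{y}_{t+1}=\mathbf{y}_t+\rho(\mathbf{A}\mathbf{x}_{t+1}+\mathbf{B}\mathbf{z}_{t+1}-\mathbf{c}).$$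 All minimizers are assumed to exist. For $\mathbf{w}=(\mathbf{x},\mathbf{z},\mathbf{y})\in\Omega$: $h(\mathbf{w})=f(\mathbf{x})+g(\mathbf{z})$ and $F(\mathbf{w})=\bigl(\mathbf{A}^T\mathbf{y},\ \mathbf{B}^T\mathbf{y},\ -(\mathbf{A}\mathbf{x}+\mathbf{B}\mathbf{z}-\mathbf{c})\bigr)\in\mathbb{R}^{n_1}\times\mathbb{R}^{n_2}\times\mathbb{R}^m$. *)

theory Defs
  imports "HOL-Analysis.Analysis"
begin

definition residual ::
  "real^'n1^'m \<Rightarrow> real^'n2^'m \<Rightarrow> real^'m \<Rightarrow> real^'n1 \<Rightarrow> real^'n2 \<Rightarrow> real^'m" where
  "residual A B c x z = A *v x + B *v z - c"

text \<open>
  The sequences are indexed so that the update at step \<open>t\<close> produces the entries \<open>t + 1\<close>. The entry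
  \<open>x 0\<close> is never used and is left unconstrained; the start value \<open>z 0 = 0\<close> need not
  lie in \<open>Z\<close>. The minimizers need not be unique, so the iteration is a relation on
  sequences; that a sequence satisfies it includes the existence of all minimizers it passes through.
\<close>

definition batch_ADM ::
  "(real^'n1) set \<Rightarrow> (real^'n2) set \<Rightarrow> (real^'n1 \<Rightarrow> real) \<Rightarrow> (real^'n2 \<Rightarrow> real) \<Rightarrow>
   real^'n1^'m \<Rightarrow> real^'n2^'m \<Rightarrow> real^'m \<Rightarrow> real \<Rightarrow>
   (nat \<Rightarrow> real^'n1) \<Rightarrow> (nat \<Rightarrow> real^'n2) \<Rightarrow> (nat \<Rightarrow> real^'m) \<Rightarrow> bool" where
  "batch_ADM X Z f g A B c \<rho> x z y \<longleftrightarrow>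
     z 0 = 0 \<and> y 0 = 0 \<and>
     (\<forall>t.
       is_arg_min
         (\<lambda>u. f u + y t \<bullet> residual A B c u (z t) + \<rho> / 2 * (norm (residual A B c u (z t)))\<^sup>2)
         (\<lambda>u. u \<in> X) (x (Suc t)) \<and>
       is_arg_min
         (\<lambda>v. g v + y t \<bullet> residual A B c (x (Suc t)) v
               + \<rho> / 2 * (norm (residual A B c (x (Suc t)) v))\<^sup>2)
         (\<lambda>v. v \<in> Z) (z (Suc t)) \<and>
       y (Suc t) = y t + \<rho> *\<^sub>R residual A B c (x (Suc t)) (z (Suc t)))"

definition h_obj ::
  "(real^'n1 \<Rightarrow> real) \<Rightarrow> (real^'n2 \<Rightarrow> real) \<Rightarrow> (real^'n1) \<times> (real^'n2) \<times> (real^'m) \<Rightarrow> real" where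
  "h_obj f g = (\<lambda>(x, z, y). f x + g z)"

definition F_op ::
  "real^'n1^'m \<Rightarrow> real^'n2^'m \<Rightarrow> real^'m \<Rightarrow>
   (real^'n1) \<times> (real^'n2) \<times> (real^'m) \<Rightarrow> (real^'n1) \<times> (real^'n2) \<times> (real^'m)" where
  "F_op A B c = (\<lambda>(x, z, y). (transpose A *v y, transpose B *v y, - residual A B c x z))"

definition avg_iterate ::
  "(nat \<Rightarrow> real^'n1) \<Rightarrow> (nat \<Rightarrow> real^'n2) \<Rightarrow> (nat \<Rightarrow> real^'m) \<Rightarrow> nat \<Rightarrow>
   (real^'n1) \<times> (real^'n2) \<times> (real^'m)" where
  "avg_iterate x z y T = (1 / real T) *\<^sub>R (\<Sum>t = 1..T. (x t, z t, y t))"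

end

theory Submission
  imports Defs
begin

text \<open>
  Since the linear part of \<open>F\<close> is skew, \<open>F\<close> may be evaluated at the fixed point \<open>w\<close> instead of the
  averaged iterate; the expression to be bounded then becomes convex in the iterate, and Jensen's
  inequality reduces the claim to a bound on \<open>\<Sum>t\<le>T. h w\<^sub>t - h w + (w\<^sub>t - w) \<bullet> F w\<^sub>t\<close>.
  With \<open>w = (x, z, y)\<close>, the first-order optimality conditions of the two subproblems bound each
  summand by the decrease in one step of
  \<open>\<parallel>y\<^sub>t - y\<parallel>\<^sup>2 / (2 \<rho>) + \<rho> / 2 * \<parallel>B z\<^sub>t + A x - c\<parallel>\<^sup>2\<close>, so the sum telescopes.
\<close>

text \<open>Letting \<open>s\<close> tend to 0 from the right discards the term of higher order in a
  variational inequality.\<close>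

lemma nonneg_if_plus_small_multiple_nonneg:
  fixes a b :: real
  assumes "\<And>s. 0 < s \<Longrightarrow> s \<le> 1 \<Longrightarrow> 0 \<le> a + s * b"
  shows "0 \<le> a"
proof (rule tendsto_lowerbound)
  show "((\<lambda>s. a + s * b) \<longlongrightarrow> a) (at_right 0)"
    by (auto intro!: tendsto_eq_intros)
  show "eventually (\<lambda>s. 0 \<le> a + s * b) (at_right 0)"
    unfolding eventually_at_right_field using assms by (intro exI[of _ 1]) auto
qed simp

text \<open>Comparing the minimizer \<open>v\<close> with points on the segment towards
  \<open>u\<close> replaces differentiation of \<open>\<phi>\<close>, which may be non-smooth:
  convexity handles \<open>\<phi>\<close>, and only the quadratic penalty is expanded.\<close>

lemma augmented_minimizer_optimality:
  fixes M :: "real^'n^'m" and d p :: "real^'m"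
  assumes "convex S" and "convex_on S \<phi>"
    and min: "is_arg_min
      (\<lambda>u. \<phi> u + p \<bullet> (M *v u + d) + \<rho> / 2 * (norm (M *v u + d))\<^sup>2) (\<lambda>u. u \<in> S) v"
    and u: "u \<in> S"
  shows "\<phi> v - \<phi> u + (M *v (v - u)) \<bullet> (p + \<rho> *\<^sub>R (M *v v + d)) \<le> 0"
proof -
  define \<psi> where "\<psi> u = \<phi> u + p \<bullet> (M *v u + d) + \<rho> / 2 * (norm (M *v u + d))\<^sup>2" for u
  define r where "r = M *v v + d"
  define e where "e = M *v (u - v)"
  have v: "v \<in> S" and le: "\<psi> v \<le> \<psi> u'" if "u' \<in> S" for u'
    using min that unfolding is_arg_min_linorder \<psi>_def by auto
  \<comment> \<open>This is the comparison of \<open>\<psi>\<close> at \<open>v\<close> and at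
    \<open>(1 - s) *\<^sub>R v + s *\<^sub>R u\<close>, divided by \<open>s\<close>.\<close>
  have "0 \<le> (\<phi> u - \<phi> v + e \<bullet> (p + \<rho> *\<^sub>R r)) + s * (\<rho> / 2 * (e \<bullet> e))"
    if s: "0 < s" "s \<le> 1" for s
  proof -
    define w where "w = (1 - s) *\<^sub>R v + s *\<^sub>R u"
    have w: "w \<in> S"
      unfolding w_def using assms(1) v[OF u] u s by (intro convexD) auto
    have \<phi>: "\<phi> w \<le> (1 - s) * \<phi> v + s * \<phi> u"
      unfolding w_def using convex_onD[OF assms(2), of s v u] v[OF u] u s by simp
    have r_w: "M *v w + d = r + s *\<^sub>R e"
      by (simp add: w_def r_def e_def algebra_simps)
    have "0 \<le> \<psi> w - \<psi> v"
      using le[OF w] by simp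
    also have "\<dots> = \<phi> w - \<phi> v + s * (e \<bullet> (p + \<rho> *\<^sub>R r)) + s * (s * (\<rho> / 2 * (e \<bullet> e)))"
      unfolding \<psi>_def r_w r_def[symmetric]
      by (simp add: power2_norm_eq_inner inner_add_left inner_add_right inner_commute algebra_simps)
    also have "\<dots> \<le> s * ((\<phi> u - \<phi> v + e \<bullet> (p + \<rho> *\<^sub>R r)) + s * (\<rho> / 2 * (e \<bullet> e)))"
      using \<phi> by (simp add: algebra_simps)
    finally show ?thesis
      using s by (simp add: zero_le_mult_iff)
  qed
  then have "0 \<le> \<phi> u - \<phi> v + e \<bullet> (p + \<rho> *\<^sub>R r)"
    by (rule nonneg_if_plus_small_multiple_nonneg)
  moreover have "M *v (v - u) = - e"
    by (simp add: e_def algebra_simps)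
  ultimately show ?thesis
    by (simp add: r_def)
qed

lemma inner_F_op:
  "(x1, z1, y1) \<bullet> F_op A B c (x, z, y) =
    (A *v x1) \<bullet> y + (B *v z1) \<bullet> y - y1 \<bullet> residual A B c x z"
  by (simp add: F_op_def inner_prod_def transpose_matrix_vector inner_commute
      flip: dot_lmul_matrix)

text \<open>\<open>F\<close> is affine, and in its linear part the blocks
  \<open>transpose A\<close>, \<open>transpose B\<close> are paired with \<open>- A\<close>,
  \<open>- B\<close>. Hence \<open>F v - F w\<close> is orthogonal to \<open>v - w\<close>.\<close>

lemma F_op_skew: "(v - w) \<bullet> F_op A B c v = (v - w) \<bullet> F_op A B c w"
proof (cases v; cases w)
  fix x z y x' z' y'
  assume "v = (x, z, y)" "w = (x', z', y')"
  then show ?thesis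
    by (simp only: diff_Pair inner_F_op)
      (simp add: residual_def inner_diff_left inner_diff_right inner_add_right inner_commute
        algebra_simps)
qed

text \<open>A polarization identity: with \<open>a\<close> fixed, and \<open>d\<close>,
  \<open>b\<close> the old and new iterate, the first two squares telescope over the
  iteration.\<close>

lemma (in real_inner) inner_diff_telescope:
  "(a - b) \<bullet> (b - d) = ((norm (d - a))\<^sup>2 - (norm (b - a))\<^sup>2 - (norm (b - d))\<^sup>2) / 2"
  by (simp add: power2_norm_eq_inner inner_diff_left inner_diff_right inner_commute algebra_simps)

lemma batch_ADM_step:
  fixes p :: "real^'m"
  assumes "convex X" and "convex Z" and "convex_on X f" and "convex_on Z g" and "\<rho> > 0"
    and adm: "batch_ADM X Z f g A B c \<rho> x z y"
    and "u \<in> X" and "v \<in> Z"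
  defines "V \<equiv> \<lambda>t. (norm (y t - p))\<^sup>2 / (2 * \<rho>) + \<rho> / 2 * (norm (B *v z t - (c - A *v u)))\<^sup>2"
  defines "w \<equiv> \<lambda>t. (x t, z t, y t)"
  shows "h_obj f g (w (Suc t)) - h_obj f g (u, v, p)
      + (w (Suc t) - (u, v, p)) \<bullet> F_op A B c (w (Suc t)) \<le> V t - V (Suc t)"
proof -
  define x' z' y' where new: "x' = x (Suc t)" "z' = z (Suc t)" "y' = y (Suc t)"
  define r where "r = residual A B c x' z'"
  define \<delta> where "\<delta> = B *v z t - B *v z'"
  define q where "q = c - A *v u"
  have y': "y' = y t + \<rho> *\<^sub>R r"
    and min_x: "is_arg_min
      (\<lambda>u. f u + y t \<bullet> (A *v u + (B *v z t - c)) + \<rho> / 2 * (norm (A *v u + (B *v z t - c)))\<^sup>2)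
      (\<lambda>u. u \<in> X) x'"
    and min_z: "is_arg_min
      (\<lambda>v. g v + y t \<bullet> (B *v v + (A *v x' - c)) + \<rho> / 2 * (norm (B *v v + (A *v x' - c)))\<^sup>2)
      (\<lambda>v. v \<in> Z) z'"
    using adm by (simp_all add: batch_ADM_def residual_def new r_def algebra_simps)
  have "A *v x' + (B *v z t - c) = r + \<delta>" and "B *v z' + (A *v x' - c) = r"
    by (simp_all add: r_def \<delta>_def residual_def)
  \<comment> \<open>The \<open>z\<close>-update already sees the new residual \<open>r\<close>, so
    its multiplier is exactly \<open>y'\<close>. The \<open>x\<close>-update still uses the old
    \<open>z t\<close>, which shifts its residual by \<open>\<delta>\<close> and its multiplier by
    \<open>\<rho> *\<^sub>R \<delta>\<close>.\<close>
  then have f: "f x' - f u + (A *v (x' - u)) \<bullet> (y' + \<rho> *\<^sub>R \<delta>) \<le> 0"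
    and g: "g z' - g v + (B *v (z' - v)) \<bullet> y' \<le> 0"
    using augmented_minimizer_optimality[OF assms(1,3) min_x assms(7)]
      augmented_minimizer_optimality[OF assms(2,4) min_z assms(8)]
    by (simp_all add: y' scaleR_add_right add.assoc)
  \<comment> \<open>Splits the error caused by the shift \<open>\<delta>\<close>: the part along
    \<open>q - B *v z'\<close> telescopes, the part along \<open>r\<close> is absorbed by a
    square.\<close>
  have A: "A *v (x' - u) = r + (q - B *v z')"
    by (simp add: r_def q_def residual_def algebra_simps)
  have dual: "(p - y') \<bullet> r =
      ((norm (y t - p))\<^sup>2 - (norm (y' - p))\<^sup>2) / (2 * \<rho>) - \<rho> / 2 * (norm r)\<^sup>2"
  proof -
    have "\<rho> * ((p - y') \<bullet> r) = (p - y') \<bullet> (y' - y t)"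
      by (simp add: y')
    also have "\<dots> = ((norm (y t - p))\<^sup>2 - (norm (y' - p))\<^sup>2 - \<rho>\<^sup>2 * (norm r)\<^sup>2) / 2"
      unfolding inner_diff_telescope by (simp add: y' power_mult_distrib)
    finally show ?thesis
      using \<open>\<rho> > 0\<close> by (simp add: field_simps power2_eq_square)
  qed
  have primal: "\<rho> * ((q - B *v z') \<bullet> \<delta>) = \<rho> / 2 * (norm (B *v z' - q))\<^sup>2
      - \<rho> / 2 * (norm (B *v z t - q))\<^sup>2 + \<rho> / 2 * (norm \<delta>)\<^sup>2"
  proof -
    have "(q - B *v z') \<bullet> \<delta> = - ((q - B *v z') \<bullet> (B *v z' - B *v z t))"
      by (simp add: \<delta>_def inner_diff_right)
    also have "\<dots> = ((norm (B *v z' - q))\<^sup>2 - (norm (B *v z t - q))\<^sup>2 + (norm \<delta>)\<^sup>2) / 2"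
      unfolding inner_diff_telescope \<delta>_def by (simp add: norm_minus_commute field_simps)
    finally have "(q - B *v z') \<bullet> \<delta> =
      ((norm (B *v z' - q))\<^sup>2 - (norm (B *v z t - q))\<^sup>2 + (norm \<delta>)\<^sup>2) / 2" .
    then show ?thesis
      by (simp only:) (simp add: algebra_simps add_divide_distrib diff_divide_distrib)
  qed
  \<comment> \<open>The non-telescoping remainders of \<open>dual\<close> and \<open>primal\<close>,
    together with the cross term in \<open>r\<close> and \<open>\<delta>\<close>, form the negative
    of this expression, which is \<open>\<rho> / 2\<close> times the squared norm of
    \<open>r + \<delta>\<close>.\<close>
  have square: "0 \<le> \<rho> / 2 * (norm r)\<^sup>2 + \<rho> * (r \<bullet> \<delta>) + \<rho> / 2 * (norm \<delta>)\<^sup>2"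
  proof -
    have "0 \<le> \<rho> / 2 * (norm (r + \<delta>))\<^sup>2"
      using \<open>\<rho> > 0\<close> by simp
    then show ?thesis
      by (simp add: power2_norm_eq_inner inner_add_left inner_add_right inner_commute
          algebra_simps)
  qed
  have "h_obj f g (w (Suc t)) - h_obj f g (u, v, p)
      + (w (Suc t) - (u, v, p)) \<bullet> F_op A B c (w (Suc t))
    = (f x' - f u + (A *v (x' - u)) \<bullet> (y' + \<rho> *\<^sub>R \<delta>)) + (g z' - g v + (B *v (z' - v)) \<bullet> y')
      - \<rho> * ((A *v (x' - u)) \<bullet> \<delta>) + (p - y') \<bullet> r"
    unfolding w_def new[symmetric]
    by (simp add: h_obj_def inner_F_op r_def[symmetric] inner_add_right inner_diff_left)
  also have "\<dots> \<le> - \<rho> * (r \<bullet> \<delta>) - \<rho> * ((q - B *v z') \<bullet> \<delta>) + (p - y') \<bullet> r"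
    using f g unfolding A by (simp add: inner_add_left algebra_simps)
  also have "\<dots> \<le> V t - V (Suc t)"
    using square unfolding primal dual V_def new[symmetric] q_def[symmetric]
    by (simp add: diff_divide_distrib)
  finally show ?thesis .
qed

lemma avg_iterate_components:
  "avg_iterate x z y T =
    ((\<Sum>t = 1..T. (1 / real T) *\<^sub>R x t), (\<Sum>t = 1..T. (1 / real T) *\<^sub>R z t),
     (\<Sum>t = 1..T. (1 / real T) *\<^sub>R y t))"
  unfolding avg_iterate_def by (simp add: sum_prod scaleR_sum_right)

lemma convex_on_average_le:
  assumes "convex_on S \<phi>" and "T \<ge> 1" and "\<And>t. t \<ge> 1 \<Longrightarrow> s t \<in> S"
  shows "\<phi> (\<Sum>t = 1..T. (1 / real T) *\<^sub>R s t) \<le> (\<Sum>t = 1..T. 1 / real T * \<phi> (s t))"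
  using assms by (intro convex_on_sum) auto

lemma h_obj_avg_iterate_le:
  assumes "convex_on X f" and "convex_on Z g" and "T \<ge> 1"
    and "\<And>t. t \<ge> 1 \<Longrightarrow> x t \<in> X" and "\<And>t. t \<ge> 1 \<Longrightarrow> z t \<in> Z"
  shows "h_obj f g (avg_iterate x z y T) \<le> (\<Sum>t = 1..T. h_obj f g (x t, z t, y t)) / real T"
  using convex_on_average_le[OF assms(1,3), of x] convex_on_average_le[OF assms(2,3), of z]
    assms(4,5)
  by (simp add: avg_iterate_components h_obj_def sum.distrib add_divide_distrib
      sum_divide_distrib)

theorem theorem2:
  fixes X :: "(real^'n1) set" and Z :: "(real^'n2) set"
    and f :: "real^'n1 \<Rightarrow> real" and g :: "real^'n2 \<Rightarrow> real"
    and A :: "real^'n1^'m" and B :: "real^'n2^'m" and c :: "real^'m"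
    and \<rho> :: real
  assumes "X \<noteq> {}" and "convex X" and "Z \<noteq> {}" and "convex Z"
    and "convex_on X f" and "convex_on Z g"
    and "\<rho> > 0"
  shows "\<forall>w \<in> X \<times> Z \<times> (UNIV :: (real^'m) set). \<exists>C :: real.
    \<forall>x z y. batch_ADM X Z f g A B c \<rho> x z y \<longrightarrow>
      (\<forall>T :: nat. T \<ge> 1 \<longrightarrow>
        h_obj f g (avg_iterate x z y T) - h_obj f g w
          + (avg_iterate x z y T - w) \<bullet> F_op A B c (avg_iterate x z y T) \<le> C / real T)"
proof
  fix w
  assume "w \<in> X \<times> Z \<times> (UNIV :: (real^'m) set)"
  then obtain u v p where w: "w = (u, v, p)" and u: "u \<in> X" and v: "v \<in> Z"
    by auto
  \<comment> \<open>The value of the potential \<open>V\<close> at \<open>t = 0\<close>, where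
    \<open>y 0 = 0\<close> and \<open>z 0 = 0\<close>. It involves no iterate, so it can be fixed
    before the sequences.\<close>
  define C where "C = (norm p)\<^sup>2 / (2 * \<rho>) + \<rho> / 2 * (norm (c - A *v u))\<^sup>2"
  show "\<exists>C :: real. \<forall>x z y. batch_ADM X Z f g A B c \<rho> x z y \<longrightarrow>
      (\<forall>T :: nat. T \<ge> 1 \<longrightarrow>
        h_obj f g (avg_iterate x z y T) - h_obj f g w
          + (avg_iterate x z y T - w) \<bullet> F_op A B c (avg_iterate x z y T) \<le> C / real T)"
  proof (intro exI[of _ C] allI impI)
    fix x z y and T :: nat
    assume adm: "batch_ADM X Z f g A B c \<rho> x z y" and T: "T \<ge> 1"
    define \<omega> where "\<omega> t = (x t, z t, y t)" for t
    define \<omega>_avg where "\<omega>_avg = avg_iterate x z y T"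
    define V where
      "V t = (norm (y t - p))\<^sup>2 / (2 * \<rho>) + \<rho> / 2 * (norm (B *v z t - (c - A *v u)))\<^sup>2" for t
    \<comment> \<open>Feasibility starts at index 1, which matches the range of the average:
      \<open>x 0\<close> and \<open>z 0\<close> may lie outside \<open>X\<close> and
      \<open>Z\<close>.\<close>
    have mem: "x t \<in> X" "z t \<in> Z" if "t \<ge> 1" for t
      using adm that by (cases t; auto simp: batch_ADM_def is_arg_min_def)+
    \<comment> \<open>With \<open>F\<close> frozen at \<open>w\<close>, the inner product is affine
      in the iterate, so it commutes with averaging; only \<open>h_obj\<close> needs Jensen's
      inequality.\<close>
    have step: "h_obj f g (\<omega> (Suc t)) - h_obj f g w + (\<omega> (Suc t) - w) \<bullet> F_op A B c w
        \<le> V t - V (Suc t)" for t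
      using batch_ADM_step[OF assms(2,4,5,6,7) adm u v, where p = p and t = t]
        F_op_skew[of "\<omega> (Suc t)" w A B c]
      by (simp add: \<omega>_def w V_def)
    have "(\<Sum>t = 1..T. h_obj f g (\<omega> t) - h_obj f g w + (\<omega> t - w) \<bullet> F_op A B c w)
        = (\<Sum>t<T. h_obj f g (\<omega> (Suc t)) - h_obj f g w + (\<omega> (Suc t) - w) \<bullet> F_op A B c w)"
      by (simp add: sum.atLeast1_atMost_eq)
    also have "\<dots> \<le> (\<Sum>t<T. V t - V (Suc t))"
      by (intro sum_mono step)
    also have "\<dots> = V 0 - V T"
      by (rule sum_lessThan_telescope')
    also have "\<dots> \<le> V 0"
    proof -
      have "0 \<le> V T"
        unfolding V_def using \<open>\<rho> > 0\<close> by (intro add_nonneg_nonneg) auto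
      then show ?thesis
        by simp
    qed
    also have "V 0 = C"
      using adm by (simp add: V_def C_def batch_ADM_def norm_minus_commute)
    finally have total:
      "(\<Sum>t = 1..T. h_obj f g (\<omega> t) - h_obj f g w + (\<omega> t - w) \<bullet> F_op A B c w) \<le> C" .
    have h: "h_obj f g \<omega>_avg \<le> (\<Sum>t = 1..T. h_obj f g (\<omega> t)) / real T"
      unfolding \<omega>_avg_def \<omega>_def using T mem by (intro h_obj_avg_iterate_le[OF assms(5,6)])
    have F: "\<omega>_avg \<bullet> F_op A B c w = (\<Sum>t = 1..T. \<omega> t \<bullet> F_op A B c w) / real T"
      by (simp add: \<omega>_avg_def \<omega>_def avg_iterate_def inner_sum_left)
    have "h_obj f g \<omega>_avg - h_obj f g w + (\<omega>_avg - w) \<bullet> F_op A B c \<omega>_avg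
        = h_obj f g \<omega>_avg - h_obj f g w + \<omega>_avg \<bullet> F_op A B c w - w \<bullet> F_op A B c w"
      unfolding F_op_skew[of \<omega>_avg w] by (simp add: inner_diff_left)
    also have "\<dots> \<le> (\<Sum>t = 1..T. h_obj f g (\<omega> t) - h_obj f g w + (\<omega> t - w) \<bullet> F_op A B c w)
        / real T"
      using h T unfolding F
      by (simp add: sum.distrib sum_subtractf inner_diff_left field_simps)
    also have "\<dots> \<le> C / real T"
      using total by (simp add: divide_right_mono)
    finally show "h_obj f g (avg_iterate x z y T) - h_obj f g w
        + (avg_iterate x z y T - w) \<bullet> F_op A B c (avg_iterate x z y T) \<le> C / real T"
      unfolding \<omega>_avg_def .
  qed
qed

end
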